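(* Suppose that for each $t\in\mathcal{T}$ the price function $c_t$ is twice differentiable, strictly increasing and convex. Then the consumption game $\mathcal{G}=(\mathcal{N},\mathcal{L},(b_n)_n)$ has a unique Nash equilibrium.
   Context: Let $\mathcal{N}=\{1,\dots,N\}$ be a finite set of consumers (players) and $\mathcal{T}=\{1,\dots,T\}$ a finite set of time periods. For each $n\in\mathcal{N}$ we are given a total energy demand $E_n$ and bounds $0\le\underline{\ell}_{n,t}\le\overline{\ell}_{n,t}$, $t\in\mathcal{T}$. The feasible set of player $n$ is $$\mathcal{L}_n=\Big\{\boldsymbol{\ell}_n=(\ell_{n,1},\dots,\ell_{n,T})\in\mathbb{R}^T:\ \sum_{t\in\mathcal{T}}\ell_{n,t}=E_n,\ \ \underline{\ell}_{n,t}\le \ell_{n,t}\le\overline{\ell}_{n,t}\ \ \forall t\in\mathcal{T}\Big\},$$ assumed nonempty, and $\mathcal{L}=\mathcal{L}_1\times\dots\times\mathcal{L}_N$. For a profile $\boldsymbol{\ell}=(\boldsymbol{\ell}_n)_{n\in\mathcal{N}}$, put $L_t=\sum_{n\in\mathcal{N}}\ell_{n,t}$, and write $\boldsymbol{\ell}_{-n}=(\boldsymbol{\ell}_m)_{m\ne n}$. Each time period $t$ has a per-unit price function $c_t:[0,\infty)\to\mathbb{R}$ (derivatives at $0$ are one-sided). Player $n$ minimizes over $\boldsymbol{\ell}_n\in\mathcal{L}_n$ the bill $$b_n(\boldsymbol{\ell}_n,\boldsymbol{\ell}_{-n})=\sum_{t\in\mathcal{T}}\ell_{n,t}\,c_t(L_t).$$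 The minimization game is $\mathcal{G}=(\mathcal{N},\mathcal{L},(b_n)_n)$. A Nash equilibrium of $\mathcal{G}$ is a profile $\boldsymbol{\ell}^{\mathrm{NE}}\in\mathcal{L}$ such that for every $n\in\mathcal{N}$ and every $\boldsymbol{\ell}_n\in\mathcal{L}_n$, $b_n(\boldsymbol{\ell}^{\mathrm{NE}}_n,\boldsymbol{\ell}^{\mathrm{NE}}_{-n})\le b_n(\boldsymbol{\ell}_n,\boldsymbol{\ell}^{\mathrm{NE}}_{-n})$. *)

theory Defs
  imports "HOL-Analysis.Analysis"
begin

text \<open>
  Players and time periods are indexed by finite types \<open>'n\<close> and \<open>'t\<close>. A profile is a vector
  \<open>l :: real ^ 't ^ 'n\<close>, so that \<open>l $ n\<close> is the load vector of player \<open>n\<close> and \<open>l $ n $ t\<close> its load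
  in period \<open>t\<close>.
\<close>

definition twice_differentiable_on :: "(real \<Rightarrow> real) \<Rightarrow> real set \<Rightarrow> bool"
    (infix \<open>twice'_differentiable'_on\<close> 50) where
  "f twice_differentiable_on S \<longleftrightarrow>
     (\<exists>f'. (\<forall>x\<in>S. (f has_real_derivative f' x) (at x within S)) \<and> f' differentiable_on S)"

text \<open>The profile \<open>(x, l\<^sub>-\<^sub>n)\<close> in which player \<open>n\<close> plays \<open>x\<close> and all others play as in \<open>l\<close>.\<close>

definition deviation :: "('s ^ 'n) \<Rightarrow> 'n \<Rightarrow> 's \<Rightarrow> 's ^ 'n" where
  "deviation l n x = (\<chi> m. if m = n then x else l $ m)"

definition profiles :: "('n \<Rightarrow> 's set) \<Rightarrow> ('s ^ 'n) set" where
  "profiles X = {l. \<forall>n. l $ n \<in> X n}"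

text \<open>Players minimize: \<open>b n\<close> is the cost of player \<open>n\<close>, a function of the whole profile.\<close>

definition nash_equilibrium ::
    "('n \<Rightarrow> 's set) \<Rightarrow> ('n \<Rightarrow> 's ^ 'n \<Rightarrow> real) \<Rightarrow> 's ^ 'n \<Rightarrow> bool" where
  "nash_equilibrium X b l \<longleftrightarrow>
     l \<in> profiles X \<and> (\<forall>n. \<forall>x\<in>X n. b n l \<le> b n (deviation l n x))"

definition feasible_loads ::
    "('n \<Rightarrow> real) \<Rightarrow> ('n \<Rightarrow> 't \<Rightarrow> real) \<Rightarrow> ('n \<Rightarrow> 't \<Rightarrow> real) \<Rightarrow> 'n \<Rightarrow> (real ^ 't) set" where
  "feasible_loads E lo hi n =
     {x. (\<Sum>t\<in>UNIV. x $ t) = E n \<and> (\<forall>t. lo n t \<le> x $ t \<and> x $ t \<le> hi n t)}"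

definition total_load :: "real ^ 't ^ 'n \<Rightarrow> 't \<Rightarrow> real" where
  "total_load l t = (\<Sum>n\<in>UNIV. l $ n $ t)"

definition bill :: "('t \<Rightarrow> real \<Rightarrow> real) \<Rightarrow> 'n \<Rightarrow> real ^ 't ^ 'n \<Rightarrow> real" where
  "bill c n l = (\<Sum>t\<in>UNIV. l $ n $ t * c t (total_load l t))"

end

theory Submission
  imports Defs
begin

text \<open>
  With \<open>d\<close> the derivative of \<open>c\<close>, the marginal cost of player \<open>n\<close> in period \<open>t\<close> is
  \<open>c t L + x * d t L\<close>, where \<open>x\<close> is the player's load and \<open>L\<close> the total load. Convexity of the
  prices makes Nash equilibria the same as solutions of the variational inequality for the marginal
  costs; a solution exists because Brouwer's theorem applies to the projection of
  \<open>l - F l\<close> onto the compact convex set of profiles.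

  For uniqueness, an equilibrium never has a strictly higher marginal cost in a period whose load
  can be lowered than in a period whose load can be raised. Since the marginal cost increases with
  both loads, no player can raise the load in a period of rising total and at the same time
  lower it in a period of falling total when passing from one equilibrium to another. As each
  player's demand is fixed, nobody then contributes to a rise of the totals, so the totals agree,
  and the same argument makes the individual loads agree.
\<close>

section \<open>Convex functions and variational inequalities\<close>

text \<open>The bound \<open>M\<close> holds for every difference quotient at 0 and passes to the
  limit. This turns inequalities along a segment into bounds on one-sided derivatives.\<close>

lemma initial_slope_le:
  fixes g :: "real \<Rightarrow> real"
  assumes "(g has_real_derivative D) (at 0 within {0..1})"
    and le: "\<And>h. 0 < h \<Longrightarrow> h \<le> 1 \<Longrightarrow> g h \<le> g 0 + h * M"
  shows "D \<le> M"
proof (rule tendsto_upperbound)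
  show "((\<lambda>h. (g h - g 0) / (h - 0)) \<longlongrightarrow> D) (at 0 within {0..1})"
    using assms(1) by (simp add: has_field_derivative_iff)
  have "(g h - g 0) / (h - 0) \<le> M" if "h \<in> {0..1}" "h \<noteq> 0" for h
    using le[of h] that by (simp add: field_simps)
  then show "\<forall>\<^sub>F h in at 0 within {0..1}. (g h - g 0) / (h - 0) \<le> M"
    by (auto simp: eventually_at_filter)
  show "at (0::real) within {0..1} \<noteq> bot"
    by (simp add: at_within_Icc_at_right)
qed

text \<open>Chain rule in which only the segment has to stay in \<open>A\<close>, so that one-sided
  derivatives at the boundary are covered.\<close>

lemma has_real_derivative_along_segment:
  fixes f :: "real \<Rightarrow> real"
  assumes "(f has_real_derivative D) (at x within A)"
    and "\<And>h. h \<in> {0..1} \<Longrightarrow> x + h * v \<in> A"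
  shows "((\<lambda>h. f (x + h * v)) has_real_derivative D * v) (at 0 within {0..1})"
proof -
  have "(f has_real_derivative D) (at (x + 0 * v) within (\<lambda>h. x + h * v) ` {0..1})"
    using assms by (auto intro: DERIV_subset)
  moreover have "((\<lambda>h. x + h * v) has_real_derivative v) (at 0 within {0..1})"
    by (auto intro!: derivative_eq_intros)
  ultimately show ?thesis
    using DERIV_image_chain[of f D "\<lambda>h. x + h * v" 0 "{0..1}" v] by (simp add: o_def)
qed

text \<open>
  Unlike \<open>convex_on_imp_above_tangent\<close>, this does not require \<open>x\<close> to be an interior point.
\<close>

lemma convex_on_above_tangent:
  fixes f :: "real \<Rightarrow> real"
  assumes conv: "convex_on A f" and x: "x \<in> A" and y: "y \<in> A"
    and deriv: "(f has_real_derivative D) (at x within A)"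
  shows "f x + D * (y - x) \<le> f y"
proof -
  have seg: "x + h * (y - x) = (1 - h) * x + h * y" for h
    by (simp add: algebra_simps)
  have "convex A"
    using conv by (simp add: convex_on_def)
  then have "x + h * (y - x) \<in> A" if "h \<in> {0..1}" for h
    using that x y convexD_alt[of A x y h] by (simp add: seg)
  then have "((\<lambda>h. f (x + h * (y - x))) has_real_derivative D * (y - x)) (at 0 within {0..1})"
    by (rule has_real_derivative_along_segment[OF deriv])
  moreover have "f (x + h * (y - x)) \<le> f (x + 0 * (y - x)) + h * (f y - f x)"
    if "0 < h" "h \<le> 1" for h
    using convex_onD[OF conv, of h x y] that x y by (simp add: seg algebra_simps)
  ultimately have "D * (y - x) \<le> f y - f x"
    by (rule initial_slope_le)
  then show ?thesis
    by simp
qed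

lemma variational_inequality_solution_exists:
  fixes F :: "'a::euclidean_space \<Rightarrow> 'a"
  assumes S: "compact S" "convex S" "S \<noteq> {}" and F: "continuous_on S F"
  obtains x where "x \<in> S" "\<And>y. y \<in> S \<Longrightarrow> 0 \<le> F x \<bullet> (y - x)"
proof -
  have cl: "closed S"
    by (simp add: S compact_imp_closed)
  have "continuous_on S (\<lambda>x. closest_point S (x - F x))"
    by (intro continuous_on_compose2[OF continuous_on_closest_point[of S UNIV]] continuous_intros F)
      (auto simp: S cl)
  then obtain x where x: "x \<in> S" "closest_point S (x - F x) = x"
    using brouwer[of S "\<lambda>x. closest_point S (x - F x)"] S cl closest_point_in_set[of S] by auto
  \<comment> \<open>The projection \<open>p\<close> of \<open>z\<close> onto \<open>S\<close>
    satisfies \<open>(z - p) \<bullet> (y - p) \<le> 0\<close>; here \<open>z = x - F x\<close> and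
    \<open>p = x\<close>.\<close>
  have "0 \<le> F x \<bullet> (y - x)" if "y \<in> S" for y
    using closest_point_dot[of S y "x - F x"] that x S cl by simp
  with x that show thesis
    by blast
qed

section \<open>The consumption game\<close>

text \<open>The derivative \<open>d\<close> is a parameter so that marginal costs can be named. Its
  continuity makes Brouwer's theorem applicable.\<close>

locale consumption_game =
  fixes E :: "'n::finite \<Rightarrow> real"
    and lo hi :: "'n \<Rightarrow> 't::finite \<Rightarrow> real"
    and c d :: "'t \<Rightarrow> real \<Rightarrow> real"
  assumes lo_nonneg: "0 \<le> lo n t"
    and feasible_nonempty: "feasible_loads E lo hi n \<noteq> {}"
    and price_deriv: "0 \<le> x \<Longrightarrow> (c t has_real_derivative d t x) (at x within {0..})"
    and continuous_slope: "continuous_on {0..} (d t)"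
    and price_strict_mono: "strict_mono_on {0..} (c t)"
    and price_convex: "convex_on {0..} (c t)"
begin

abbreviation "X \<equiv> feasible_loads E lo hi"

definition marginal_cost :: "'t \<Rightarrow> real \<Rightarrow> real \<Rightarrow> real" where
  "marginal_cost t x L = c t L + x * d t L"

text \<open>Pseudo-gradient of the game: row \<open>n\<close> differentiates the bill of player
  \<open>n\<close> in that player's own loads, so different rows belong to different
  functions.\<close>

definition gradient :: "real ^ 't ^ 'n \<Rightarrow> real ^ 't ^ 'n" where
  "gradient l = (\<chi> n t. marginal_cost t (l $ n $ t) (total_load l t))"

section \<open>Monotonicity of prices, slopes and marginal costs\<close>

lemma price_above_tangent:
  "0 \<le> x \<Longrightarrow> 0 \<le> y \<Longrightarrow> c t x + d t x * (y - x) \<le> c t y"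
  by (rule convex_on_above_tangent[OF price_convex]) (auto intro: price_deriv)

lemma price_less: "0 \<le> x \<Longrightarrow> x < y \<Longrightarrow> c t x < c t y"
  using price_strict_mono by (auto simp: strict_mono_on_def)

lemma price_le: "0 \<le> x \<Longrightarrow> x \<le> y \<Longrightarrow> c t x \<le> c t y"
  using price_less[of x y t] by (cases "x = y") auto

text \<open>Strict monotonicity alone would allow an isolated zero of the slope; the tangent at
  \<open>x\<close>, evaluated at 0, excludes it by convexity.\<close>

lemma slope_pos:
  assumes "0 < x"
  shows "0 < d t x"
proof -
  have "c t 0 < c t x" "c t x + d t x * (0 - x) \<le> c t 0"
    using price_less[of 0 x] price_above_tangent[of x 0] assms by auto
  then have "0 < d t x * x"
    by simp
  with assms show ?thesis
    by (simp add: zero_less_mult_iff)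
qed

lemma slope_mono:
  assumes "0 \<le> x" "x \<le> y"
  shows "d t x \<le> d t y"
proof (cases "x = y")
  case False
  have "c t x + d t x * (y - x) \<le> c t y" "c t y + d t y * (x - y) \<le> c t x"
    using price_above_tangent assms by auto
  then have "d t x * (y - x) \<le> d t y * (y - x)"
    by (simp add: algebra_simps)
  with False assms show ?thesis
    by simp
qed simp

lemma slope_nonneg:
  assumes "0 \<le> x"
  shows "0 \<le> d t x"
proof (cases "x = 0")
  case True
  \<comment> \<open>At 0 the slope may vanish; its sign comes from the difference quotients of the
    increasing price.\<close>
  have "((\<lambda>h. - c t h) has_real_derivative - d t 0) (at 0 within {0..1})"
    by (intro DERIV_minus DERIV_subset[OF price_deriv]) auto
  then have "- d t 0 \<le> 0"
    by (rule initial_slope_le) (use price_le[of 0] in auto)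
  with True show ?thesis
    by simp
next
  case False
  with assms slope_pos[of x t] show ?thesis
    by simp
qed

text \<open>Strictness comes from the factor \<open>d t M\<close>: the bound
  \<open>y \<le> M\<close> makes \<open>M\<close> positive, hence also the slope there.\<close>

lemma marginal_cost_strict_mono:
  assumes "0 \<le> x" "x < y" "y \<le> M" "0 \<le> L" "L \<le> M"
  shows "marginal_cost t x L < marginal_cost t y M"
proof -
  have "x * d t L \<le> x * d t M"
    using assms slope_mono by (intro mult_left_mono) auto
  also have "\<dots> < y * d t M"
    using assms slope_pos[of M t] by simp
  finally show ?thesis
    using price_le[of L M t] assms by (simp add: marginal_cost_def)
qed

section \<open>Profiles and unilateral deviations\<close>

lemma profile_bounds:
  assumes "l \<in> profiles X"
  shows "lo n t \<le> l $ n $ t" "l $ n $ t \<le> hi n t" "0 \<le> l $ n $ t"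
    "(\<Sum>t\<in>UNIV. l $ n $ t) = E n"
  using assms lo_nonneg[of n t] order_trans[of 0 "lo n t" "l $ n $ t"]
  by (auto simp: profiles_def feasible_loads_def)

lemma load_le_total_load:
  assumes "l \<in> profiles X"
  shows "l $ n $ t \<le> total_load l t"
  unfolding total_load_def by (rule member_le_sum) (auto simp: profile_bounds[OF assms])

lemma total_load_nonneg:
  assumes "l \<in> profiles X"
  shows "0 \<le> total_load l t"
  unfolding total_load_def by (rule sum_nonneg) (auto simp: profile_bounds[OF assms])

lemma deviation_nth: "deviation l n x $ n = x"
  by (simp add: deviation_def)

lemma deviation_in_profiles:
  "l \<in> profiles X \<Longrightarrow> x \<in> X n \<Longrightarrow> deviation l n x \<in> profiles X"
  by (simp add: profiles_def deviation_def)

lemma total_load_deviation: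
  fixes l :: "real ^ 't ^ 'n"
  shows "total_load (deviation l n x) t = total_load l t + (x $ t - l $ n $ t)"
  by (simp add: total_load_def deviation_def sum.remove[of UNIV n])

section \<open>Convexity and compactness of the strategy sets, continuity of the gradient\<close>

lemma feasible_eq: "X n = {x. (\<Sum>t\<in>UNIV. x $ t) = E n} \<inter> cbox (\<chi> t. lo n t) (\<chi> t. hi n t)"
  by (auto simp: feasible_loads_def mem_box_cart)

lemma convex_feasible: "convex (X n)"
proof -
  have "convex {x :: real ^ 't. (\<Sum>t\<in>UNIV. x $ t) = E n}"
    by (simp add: convex_def sum.distrib flip: sum_distrib_left distrib_right)
  then show ?thesis
    unfolding feasible_eq by (intro convex_Int convex_box)
qed

lemma compact_feasible: "compact (X n)"
proof -
  have "closed {x::real ^ 't. (\<Sum>t\<in>UNIV. x $ t) = E n}"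
    by (intro closed_Collect_eq continuous_intros)
  then show ?thesis
    unfolding feasible_eq by (intro closed_Int_compact compact_cbox)
qed

lemma profiles_nonempty: "profiles X \<noteq> {}"
proof -
  have "(\<chi> n. SOME x. x \<in> X n) \<in> profiles X"
    using feasible_nonempty by (auto simp: profiles_def some_in_eq)
  then show ?thesis
    by blast
qed

lemma convex_profiles: "convex (profiles X)"
  using convex_feasible by (simp add: convex_def profiles_def)

lemma compact_profiles: "compact (profiles X)"
proof -
  have "closed (profiles X)"
    unfolding profiles_def
    by (intro closed_Collect_all closed_vimage[unfolded vimage_def] continuous_intros
        compact_imp_closed compact_feasible)
  moreover have "profiles X \<subseteq> cbox (\<chi> n t. lo n t) (\<chi> n t. hi n t)"
    by (auto simp: mem_box Basis_vec_def inner_axis profile_bounds)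
  ultimately show ?thesis
    using bounded_subset[OF bounded_cbox] by (auto simp: compact_eq_bounded_closed)
qed

lemma continuous_on_gradient: "continuous_on (profiles X) gradient"
proof -
  have price: "continuous_on {0..} (c t)" for t
    by (rule DERIV_continuous_on) (auto intro: price_deriv)
  have load: "continuous_on A (\<lambda>l :: real ^ 't ^ 'n. total_load l t)" for A t
    unfolding total_load_def by (intro continuous_intros)
  show ?thesis
    unfolding gradient_def marginal_cost_def
    by (intro continuous_intros continuous_on_compose2[OF price] load
        continuous_on_compose2[OF continuous_slope]) (auto simp: total_load_nonneg)
qed

section \<open>Nash equilibria as solutions of a variational inequality\<close>

text \<open>The tangent inequality for the price, multiplied by the nonnegative new load, bounds the
  new bill below by its linearization plus the nonnegative terms
  \<open>d t ?L * ?v\<^sup>2\<close>.\<close>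

lemma nash_equilibriumI:
  assumes l: "l \<in> profiles X"
    and vi: "\<And>n x. x \<in> X n \<Longrightarrow> 0 \<le> gradient l $ n \<bullet> (x - l $ n)"
  shows "nash_equilibrium X (bill c) l"
  unfolding nash_equilibrium_def
proof (intro conjI allI ballI l)
  fix n x assume x: "x \<in> X n"
  let ?l' = "deviation l n x"
  have l': "?l' \<in> profiles X"
    using l x by (rule deviation_in_profiles)
  have "l $ n $ t * c t (total_load l t) + gradient l $ n $ t * (x $ t - l $ n $ t)
      \<le> ?l' $ n $ t * c t (total_load ?l' t)" for t
  proof -
    let ?L = "total_load l t" and ?v = "x $ t - l $ n $ t"
    have "c t ?L + d t ?L * ?v \<le> c t (total_load ?l' t)"
      using price_above_tangent[of ?L "total_load ?l' t" t]
        total_load_nonneg[OF l] total_load_nonneg[OF l'] by (simp add: total_load_deviation)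
    then have "x $ t * (c t ?L + d t ?L * ?v) \<le> ?l' $ n $ t * c t (total_load ?l' t)"
      using profile_bounds(3)[OF l', of n t] by (simp add: deviation_nth mult_left_mono)
    moreover have "0 \<le> d t ?L * ?v\<^sup>2"
      by (simp add: slope_nonneg total_load_nonneg[OF l])
    ultimately show ?thesis
      by (simp add: gradient_def marginal_cost_def algebra_simps power2_eq_square)
  qed
  then have "bill c n l + gradient l $ n \<bullet> (x - l $ n) \<le> bill c n ?l'"
    by (simp add: bill_def inner_vec_def sum_mono flip: sum.distrib)
  with vi[OF x] show "bill c n l \<le> bill c n ?l'"
    by simp
qed

text \<open>Along the segment from \<open>l $ n\<close> to \<open>x\<close> the bill never drops
  below its initial value, so its one-sided derivative at the start is nonnegative.\<close>

lemma nash_equilibriumD: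
  assumes "nash_equilibrium X (bill c) l" and x: "x \<in> X n"
  shows "0 \<le> gradient l $ n \<bullet> (x - l $ n)"
proof -
  have l: "l \<in> profiles X"
    and ne: "\<And>n x. x \<in> X n \<Longrightarrow> bill c n l \<le> bill c n (deviation l n x)"
    using assms(1) by (auto simp: nash_equilibrium_def)
  define v where "v = x - l $ n"
  define y where "y h = l $ n + h *\<^sub>R v" for h
  have y: "y h \<in> X n" if "h \<in> {0..1}" for h
  proof -
    have "l $ n \<in> X n"
      using l by (simp add: profiles_def)
    then have "(1 - h) *\<^sub>R l $ n + h *\<^sub>R x \<in> X n"
      using that x by (intro convexD_alt convex_feasible) auto
    then show ?thesis
      by (simp add: y_def v_def algebra_simps)
  qed
  have bill_y: "bill c n (deviation l n (y h)) =
      (\<Sum>t\<in>UNIV. (l $ n $ t + h * v $ t) * c t (total_load l t + h * v $ t))" for h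
    by (simp add: bill_def deviation_nth total_load_deviation y_def)
  have "((\<lambda>h. c t (total_load l t + h * v $ t)) has_real_derivative
      d t (total_load l t) * v $ t) (at 0 within {0..1})" for t
  proof (rule has_real_derivative_along_segment)
    show "(c t has_real_derivative d t (total_load l t)) (at (total_load l t) within {0..})"
      by (simp add: price_deriv total_load_nonneg[OF l])
    show "total_load l t + h * v $ t \<in> {0..}" if "h \<in> {0..1}" for h
      using total_load_nonneg[OF deviation_in_profiles[OF l y[OF that]], of t]
      by (simp add: total_load_deviation y_def)
  qed
  \<comment> \<open>The bill is negated because \<open>initial_slope_le\<close> bounds slopes from
    above.\<close>
  then have "((\<lambda>h. - bill c n (deviation l n (y h))) has_real_derivative - (gradient l $ n \<bullet> v))
      (at 0 within {0..1})"
    unfolding bill_y inner_vec_def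
    by (auto intro!: derivative_eq_intros sum.cong
        simp: gradient_def marginal_cost_def algebra_simps)
  moreover have "- bill c n (deviation l n (y h)) \<le> - bill c n (deviation l n (y 0)) + h * 0"
    if "0 < h" "h \<le> 1" for h
    using ne[OF y, of h] that by (simp add: bill_y) (simp add: bill_def)
  ultimately have "- (gradient l $ n \<bullet> v) \<le> 0"
    by (rule initial_slope_le)
  then show ?thesis
    by (simp add: v_def)
qed

lemma nash_equilibrium_exists: "\<exists>l. nash_equilibrium X (bill c) l"
proof -
  obtain l where l: "l \<in> profiles X"
    and vi: "\<And>y. y \<in> profiles X \<Longrightarrow> 0 \<le> gradient l \<bullet> (y - l)"
    using variational_inequality_solution_exists[OF compact_profiles convex_profiles
        profiles_nonempty continuous_on_gradient] by blast
  have "0 \<le> gradient l $ n \<bullet> (x - l $ n)" if "x \<in> X n" for n x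
  proof -
    \<comment> \<open>A unilateral deviation changes only row \<open>n\<close>, so the inequality on
      the product set yields one for each player.\<close>
    have "gradient l \<bullet> (deviation l n x - l) =
        (\<Sum>m\<in>UNIV. if m = n then gradient l $ n \<bullet> (x - l $ n) else 0)"
      unfolding inner_vec_def[of "gradient l"] by (rule sum.cong) (auto simp: deviation_def)
    then show ?thesis
      using vi[OF deviation_in_profiles[OF l that]] by simp
  qed
  with l show ?thesis
    using nash_equilibriumI by blast
qed

section \<open>Uniqueness\<close>

text \<open>Shifting a little load from \<open>s\<close> to \<open>t\<close> is feasible, and its
  first-order effect on the bill is the shift times the difference of the marginal costs.\<close>

lemma equilibrium_marginal_cost_le:
  assumes ne: "nash_equilibrium X (bill c) l"
    and s: "lo n s < l $ n $ s" and t: "l $ n $ t < hi n t"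
  shows "marginal_cost s (l $ n $ s) (total_load l s) \<le> marginal_cost t (l $ n $ t) (total_load l t)"
proof (cases "s = t")
  case False
  have l: "l \<in> profiles X"
    using ne by (simp add: nash_equilibrium_def)
  \<comment> \<open>The largest shift that both bounds permit.\<close>
  define e where "e = min (l $ n $ s - lo n s) (hi n t - l $ n $ t)"
  have e: "0 < e" "e \<le> l $ n $ s - lo n s" "e \<le> hi n t - l $ n $ t"
    using s t by (auto simp: e_def)
  define v :: "real ^ 't" where "v = e *\<^sub>R (axis t 1 - axis s 1)"
  have "lo n r \<le> (l $ n + v) $ r \<and> (l $ n + v) $ r \<le> hi n r" for r
    using e profile_bounds(1,2)[OF l, of n r] by (auto simp: v_def axis_def)
  moreover have "(\<Sum>r\<in>UNIV. (l $ n + v) $ r) = E n"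
    using profile_bounds(4)[OF l, of n]
    by (simp add: v_def axis_def sum.distrib sum_subtractf flip: sum_distrib_left)
  ultimately have "l $ n + v \<in> X n"
    by (simp add: feasible_loads_def)
  then have "0 \<le> gradient l $ n \<bullet> v"
    using nash_equilibriumD[OF ne, of "l $ n + v" n] by simp
  also have "\<dots> = e * (gradient l $ n $ t - gradient l $ n $ s)"
    by (simp add: v_def inner_diff_right inner_axis)
  finally show ?thesis
    using e by (simp add: gradient_def zero_le_mult_iff)
qed simp

text \<open>A crossing would close a cycle of marginal costs: optimality of \<open>l\<close> leads
  from \<open>s\<close> to \<open>t\<close>, optimality of \<open>l'\<close> leads back, and
  monotonicity makes a strict step in each period.\<close>

lemma equilibria_loads_do_not_cross:
  assumes ne: "nash_equilibrium X (bill c) l" "nash_equilibrium X (bill c) l'"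
    and t: "l $ n $ t < l' $ n $ t" "total_load l t \<le> total_load l' t"
    and s: "total_load l' s \<le> total_load l s"
  shows "l $ n $ s \<le> l' $ n $ s"
proof (rule ccontr)
  assume "\<not> l $ n $ s \<le> l' $ n $ s"
  then have less: "l' $ n $ s < l $ n $ s"
    by simp
  have l: "l \<in> profiles X" and l': "l' \<in> profiles X"
    using ne by (auto simp: nash_equilibrium_def)
  \<comment> \<open>The loads in \<open>l'\<close> witness the slack of \<open>l\<close>: room to
    lower at \<open>s\<close> and to raise at \<open>t\<close>.\<close>
  have "marginal_cost s (l $ n $ s) (total_load l s)
      \<le> marginal_cost t (l $ n $ t) (total_load l t)"
    using less t profile_bounds[OF l']
    by (intro equilibrium_marginal_cost_le[OF ne(1)]) (blast intro: le_less_trans less_le_trans)+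
  also have "\<dots> < marginal_cost t (l' $ n $ t) (total_load l' t)"
    using t by (intro marginal_cost_strict_mono)
      (auto simp: l l' profile_bounds total_load_nonneg load_le_total_load)
  also have "\<dots> \<le> marginal_cost s (l' $ n $ s) (total_load l' s)"
    using less t profile_bounds[OF l]
    by (intro equilibrium_marginal_cost_le[OF ne(2)]) (blast intro: le_less_trans less_le_trans)+
  also have "\<dots> < marginal_cost s (l $ n $ s) (total_load l s)"
    using less s by (intro marginal_cost_strict_mono)
      (auto simp: l l' profile_bounds total_load_nonneg load_le_total_load)
  finally show False .
qed

lemma equilibria_total_load_le:
  assumes ne: "nash_equilibrium X (bill c) l" "nash_equilibrium X (bill c) l'"
  shows "total_load l' t \<le> total_load l t"
proof (rule ccontr)
  assume "\<not> total_load l' t \<le> total_load l t"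
  define T where "T = {t. total_load l t < total_load l' t}"
  have "t \<in> T"
    using \<open>\<not> _\<close> by (simp add: T_def)
  have l: "l \<in> profiles X" and l': "l' \<in> profiles X"
    using ne by (auto simp: nash_equilibrium_def)
  have split: "(\<Sum>t\<in>T. x $ t) = (\<Sum>t\<in>UNIV. x $ t) - (\<Sum>t\<in>- T. x $ t)" for x :: "real ^ 't"
    using sum.subset_diff[of T UNIV "\<lambda>t. x $ t"] by (simp add: Compl_eq_Diff_UNIV)
  \<comment> \<open>A player whose load rises somewhere in \<open>T\<close> lowers it nowhere
    outside, so the fixed demand keeps the sum over \<open>T\<close> from growing.\<close>
  have "(\<Sum>t\<in>T. l' $ n $ t) \<le> (\<Sum>t\<in>T. l $ n $ t)" for n
  proof (cases "\<exists>t\<in>T. l $ n $ t < l' $ n $ t")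
    case True
    then obtain t where t: "l $ n $ t < l' $ n $ t" "total_load l t \<le> total_load l' t"
      by (auto simp: T_def)
    have "l $ n $ s \<le> l' $ n $ s" if "s \<in> - T" for s
      using that by (intro equilibria_loads_do_not_cross[OF ne t]) (simp add: T_def)
    then have "(\<Sum>s\<in>- T. l $ n $ s) \<le> (\<Sum>s\<in>- T. l' $ n $ s)"
      by (rule sum_mono)
    then show ?thesis
      by (simp add: split profile_bounds(4)[OF l] profile_bounds(4)[OF l'])
  next
    case False
    then show ?thesis
      by (intro sum_mono) (simp add: not_less)
  qed
  then have "(\<Sum>n\<in>UNIV. \<Sum>t\<in>T. l' $ n $ t) \<le> (\<Sum>n\<in>UNIV. \<Sum>t\<in>T. l $ n $ t)"
    by (rule sum_mono)
  then have "(\<Sum>t\<in>T. total_load l' t) \<le> (\<Sum>t\<in>T. total_load l t)"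
    unfolding total_load_def by (subst (1 2) sum.swap)
  moreover have "(\<Sum>t\<in>T. total_load l t) < (\<Sum>t\<in>T. total_load l' t)"
    using \<open>t \<in> T\<close> by (intro sum_strict_mono) (auto simp: T_def)
  ultimately show False
    by simp
qed

lemma nash_equilibrium_unique:
  assumes ne: "nash_equilibrium X (bill c) l" "nash_equilibrium X (bill c) l'"
  shows "l = l'"
proof -
  have total: "total_load l t = total_load l' t" for t
    using equilibria_total_load_le[OF ne] equilibria_total_load_le[OF ne(2,1)]
    by (intro antisym)
  have l: "l \<in> profiles X" and l': "l' \<in> profiles X"
    using ne by (auto simp: nash_equilibrium_def)
  have le: "l' $ n $ t \<le> l $ n $ t" for n t
  proof (rule ccontr)
    assume "\<not> ?thesis"
    then have t: "l $ n $ t < l' $ n $ t"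
      by simp
    \<comment> \<open>With equal totals, a rise in one period excludes a fall in any other, so the
      player's demand would grow.\<close>
    then have "l $ n $ s \<le> l' $ n $ s" for s
      by (intro equilibria_loads_do_not_cross[OF ne]) (auto simp: total)
    with t have "(\<Sum>t\<in>UNIV. l $ n $ t) < (\<Sum>t\<in>UNIV. l' $ n $ t)"
      by (intro sum_strict_mono_ex1) auto
    then show False
      by (simp add: profile_bounds(4)[OF l] profile_bounds(4)[OF l'])
  qed
  have "l $ n $ t = l' $ n $ t" for n t
    using sum_mono_inv[of "\<lambda>t. l' $ n $ t" UNIV "\<lambda>t. l $ n $ t" t] le
      profile_bounds(4)[OF l, of n] profile_bounds(4)[OF l', of n] by simp
  then show ?thesis
    by (simp add: vec_eq_iff)
qed

end

theorem theorem1: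
  fixes E :: "'n::finite \<Rightarrow> real"
    and lo hi :: "'n \<Rightarrow> 't::finite \<Rightarrow> real"
    and c :: "'t \<Rightarrow> real \<Rightarrow> real"
  assumes "\<And>n t. 0 \<le> lo n t"
    and "\<And>n t. lo n t \<le> hi n t"
    and "\<And>n. feasible_loads E lo hi n \<noteq> {}"
    and "\<And>t. c t twice_differentiable_on {0..}"
    and "\<And>t. strict_mono_on {0..} (c t)"
    and "\<And>t. convex_on {0..} (c t)"
  shows "\<exists>!l. nash_equilibrium (feasible_loads E lo hi) (bill c) l"
proof -
  have "\<forall>t. \<exists>f'. (\<forall>x\<in>{0..}. (c t has_real_derivative f' x) (at x within {0..})) \<and>
      f' differentiable_on {0..}"
    using assms(4) by (simp add: twice_differentiable_on_def)
  \<comment> \<open>One derivative per period is chosen, for all periods simultaneously.\<close>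
  then obtain d where d: "\<And>t x. 0 \<le> x \<Longrightarrow> (c t has_real_derivative d t x) (at x within {0..})"
    "\<And>t. d t differentiable_on {0..}"
    by (metis atLeast_iff)
  interpret consumption_game E lo hi c d
    using assms d by unfold_locales (auto intro: differentiable_imp_continuous_on)
  show ?thesis
    using nash_equilibrium_exists nash_equilibrium_unique by blast
qed

end
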